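(* There is a universal constant $C>0$ (large, and in particular independent of $n$ below) such that the following holds. Let $A(j)$, $j\in\mathbb{Z}$, be an infinite sequence in $\mathrm{SL}(2,\mathbb{R})$, and suppose there is a $\lambda>C$ such that for each $j\in\mathbb{Z}$, $$\|A(j)\|\ge\lambda,\qquad \bigl|\log\|A(j+1)\|+\log\|A(j)\|-\log\|A(j+1)A(j)\|\bigr|\le\tfrac12\log\lambda.$$ Then the sequence $A(j)$, $j\in\mathbb{Z}$, is uniformly hyperbolic, and for each $j\in\mathbb{Z}$ and each $n\in\mathbb{Z}_+$, $$\left|\log\|A_n(j)\|+\sum_{k=1}^{n-2}\log\|A(j+k)\|-\sum_{k=0}^{n-2}\log\|A(j+k+1)A(j+k)\|\right|\le C\frac{n}{\lambda}.$$
   Context: $\mathbb{Z}_+$ is the set of positive integers. For $A:\mathbb{Z}\to\mathrm{SL}(2,\mathbb{R})$ and $j\in\mathbb{Z}$ set $A_n(j)=A(j+n-1)\cdots A(j)$ for $n\ge1$, $A_0(j)=I_2$, and $A_n(j)=A(j+n)^{-1}\cdots A(j-1)^{-1}$ for $n\le-1$. $\|\cdot\|$ is the Euclidean norm on $\mathbb{R}^2$ and the operator norm on matrices. $\mathbb{RP}^1=\mathbb{R}/(\pi\mathbb{Z})$ is the set of lines through the origin of $\mathbb{R}^2$ (identified with angles), $B\cdot\theta$ is the induced action of $B\in\mathrm{SL}(2,\mathbb{R})$ on $\theta\in\mathbb{RP}^1$, and $\vec v\in\theta$ means that $\vec v$ lies on the line $\theta$. $A$ is called uniformly hyperbolic if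 there are maps $u,s:\mathbb{Z}\to\mathbb{RP}^1$ such that (1) $A(j)\cdot u(j)=u(j+1)$ and $A(j)\cdot s(j)=s(j+1)$ for all $j\in\mathbb{Z}$; (2) there exist $C'>0$, $\lambda'>1$ such that $\|A_{-n}(j)\vec v\|\le C'\lambda'^{-n}$ and $\|A_n(j)\vec w\|\le C'\lambda'^{-n}$ for all $n\ge1$, all $j\in\mathbb{Z}$ and all unit vectors $\vec v\in u(j)$, $\vec w\in s(j)$.
   Formalization: For n=1 the sum over k from 1 to n-2=-1 is read as -log||A(j)|| (oriented sum), so the estimate is trivial there; with the empty sum read as 0 it would say |log||A(j)||| ≤ C/λ, which is false for A(j)=diag(λ,1/λ). For n≥2 nothing is changed. *)

theory Defs
  imports "HOL-Analysis.Analysis"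
begin

definition SL2 :: "(real^2^2) set" where
  "SL2 = {B. det B = 1}"

definition opnorm :: "real^2^2 \<Rightarrow> real" where
  "opnorm B = onorm (\<lambda>v. B *v v)"

primrec forward_iter :: "(int \<Rightarrow> real^2^2) \<Rightarrow> nat \<Rightarrow> int \<Rightarrow> real^2^2" where
  "forward_iter A 0 j = mat 1"
| "forward_iter A (Suc n) j = A (j + int n) ** forward_iter A n j"

text \<open>\<open>backward_iter A n j\<close> is the product \<open>A(j-n)\<inverse> ** \<dots> ** A(j-1)\<inverse>\<close>,
  i.e. the iterate of index \<open>- n\<close>.\<close>

primrec backward_iter :: "(int \<Rightarrow> real^2^2) \<Rightarrow> nat \<Rightarrow> int \<Rightarrow> real^2^2" where
  "backward_iter A 0 j = mat 1"
| "backward_iter A (Suc n) j = matrix_inv (A (j - int (Suc n))) ** backward_iter A n j"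

definition iter :: "(int \<Rightarrow> real^2^2) \<Rightarrow> int \<Rightarrow> int \<Rightarrow> real^2^2" where
  "iter A n j = (if n \<ge> 0 then forward_iter A (nat n) j else backward_iter A (nat (- n)) j)"

definition RP1 :: "(real^2) set set" where
  "RP1 = {L. subspace L \<and> dim L = 1}"

definition proj_act :: "real^2^2 \<Rightarrow> (real^2) set \<Rightarrow> (real^2) set" where
  "proj_act B L = (\<lambda>v. B *v v) ` L"

definition uniformly_hyperbolic :: "(int \<Rightarrow> real^2^2) \<Rightarrow> bool" where
  "uniformly_hyperbolic A \<longleftrightarrow>
    (\<exists>u s :: int \<Rightarrow> (real^2) set.
      (\<forall>j. u j \<in> RP1 \<and> s j \<in> RP1) \<and>
      (\<forall>j. proj_act (A j) (u j) = u (j + 1) \<and> proj_act (A j) (s j) = s (j + 1)) \<and>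
      (\<exists>C' \<mu> :: real. C' > 0 \<and> \<mu> > 1 \<and>
        (\<forall>n::int. n \<ge> 1 \<longrightarrow> (\<forall>j.
          (\<forall>v\<in>u j. norm v = 1 \<longrightarrow> norm (iter A (- n) j *v v) \<le> C' * \<mu> powi (- n)) \<and>
          (\<forall>w\<in>s j. norm w = 1 \<longrightarrow> norm (iter A n j *v w) \<le> C' * \<mu> powi (- n))))))"

text \<open>A sum from \<open>a\<close> to \<open>b\<close> in the oriented convention, that is, \<open>F b - F (a - 1)\<close> for any
  \<open>F\<close> with \<open>F k - F (k - 1) = f k\<close>. It is the ordinary sum if \<open>b \<ge> a - 1\<close> (empty if
  \<open>b = a - 1\<close>), and \<open>oriented_sum f a (a - 2) = - f (a - 1)\<close>. The convention matters only for
  a sum from \<open>1\<close> to \<open>n - 2\<close> with \<open>n = 1\<close>. Reading that one as \<open>0\<close> would make the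
  estimate for \<open>n = 1\<close> say that \<open>ln \<parallel>A j\<parallel>\<close> is small, which is false for large \<open>\<parallel>A j\<parallel>\<close>.\<close>

definition oriented_sum :: "(int \<Rightarrow> real) \<Rightarrow> int \<Rightarrow> int \<Rightarrow> real" where
  "oriented_sum f a b = (if a \<le> b + 1 then (\<Sum>k=a..b. f k) else - (\<Sum>k=b+1..a-1. f k))"

end

theory Submission
  imports Defs
begin

text \<open>
  Write \<open>J\<close> for the rotation by a right angle, \<open>a j = \<parallel>A j\<parallel>\<close>, and take unit vectors with
  \<open>A j r j = a j u j\<close> and \<open>A j (J (r j)) = J (u j) / a j\<close>. With \<open>L\<^sup>2 = \<lambda>\<close>, the hypothesis on
  \<open>\<parallel>A (j + 1) A j\<parallel>\<close> forces \<open>c j = \<bar>r (j + 1) \<bullet> u j\<bar> \<ge> 1 / (2 L)\<close>. Let \<open>X\<close>, \<open>Y\<close> be the coordinates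
  in the frame \<open>u j, J (u j)\<close>. Then \<open>A (j + 1)\<close> maps the cone \<open>\<bar>Y\<bar> \<le> \<bar>X\<bar> / (8 L)\<close> into the
  narrower cone \<open>\<bar>Y\<bar> \<le> 6 \<bar>X\<bar> / L\<^sup>3\<close> and at least doubles \<open>\<bar>X\<bar>\<close>, while \<open>\<bar>Y\<bar>\<close> is at least halved
  outside the wide cone.

  In the narrow cone \<open>\<bar>X\<bar>\<close> is multiplied by \<open>a (j + 1) c j (1 + O(1 / \<lambda>))\<close>, and a norm adapted to
  this cone grows by at most such a factor on the whole plane. Hence
  \<open>ln \<parallel>A\<^sub>n(j)\<parallel> = \<Sum> ln a + \<Sum> ln c + O(n / \<lambda>)\<close>, and the case \<open>n = 2\<close> eliminates the \<open>c\<close>.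

  The stable direction consists of the vectors with bounded forward orbit. It contains a unit
  vector because the unit vectors whose first \<open>n\<close> iterates avoid the open wide cone form a
  decreasing sequence of nonempty compact sets. The unstable direction is the stable direction of
  \<open>j \<mapsto> (A (- j))\<inverse>\<close>, for which \<open>J u\<close> and \<open>J r\<close> exchange the roles of \<open>r\<close> and \<open>u\<close>.
\<close>

section \<open>Orthonormal frames of the plane\<close>

definition quarter_turn :: "real^2 \<Rightarrow> real^2" where
  "quarter_turn v = vector [- (v $ 2), v $ 1]"

lemma quarter_turn_component [simp]:
  "quarter_turn v $ 1 = - (v $ 2)" "quarter_turn v $ 2 = v $ 1"
  by (simp_all add: quarter_turn_def)

lemma inner_2: "(v::real^2) \<bullet> w = v $ 1 * w $ 1 + v $ 2 * w $ 2"
  by (simp add: inner_vec_def sum_2)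

lemma matrix_vector_2_component:
  "((B::real^2^2) *v v) $ i = B $ i $ 1 * v $ 1 + B $ i $ 2 * v $ 2"
  by (simp add: matrix_vector_mult_def sum_2)

lemma quarter_turn_quarter_turn [simp]: "quarter_turn (quarter_turn v) = - v"
  by (simp add: vec_eq_iff forall_2)

lemma quarter_turn_scaleR [simp]: "quarter_turn (t *\<^sub>R v) = t *\<^sub>R quarter_turn v"
  by (simp add: vec_eq_iff forall_2)

lemma inner_quarter_turn [simp]: "quarter_turn v \<bullet> quarter_turn w = v \<bullet> w"
  by (simp add: inner_2)

lemma inner_quarter_turn_self [simp]: "v \<bullet> quarter_turn v = 0" "quarter_turn v \<bullet> v = 0"
  by (simp_all add: inner_2)

lemma norm_quarter_turn [simp]: "norm (quarter_turn v) = norm v"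
  by (simp add: norm_eq_sqrt_inner)

text \<open>The form \<open>quarter_turn v \<bullet> w\<close> is the determinant with columns
  \<open>v\<close> and \<open>w\<close>, so a matrix multiplies it by its determinant.\<close>

lemma inner_quarter_turn_matrix:
  "quarter_turn (B *v v) \<bullet> (B *v w) = det B * (quarter_turn v \<bullet> w)"
  by (simp add: inner_2 matrix_vector_2_component det_2 algebra_simps)

lemma expand_in_frame:
  assumes "norm e = 1"
  shows "v = (e \<bullet> v) *\<^sub>R e + (quarter_turn e \<bullet> v) *\<^sub>R quarter_turn e"
proof -
  have e: "e $ 1 * e $ 1 + e $ 2 * e $ 2 = 1"
    using assms by (simp add: norm_eq_1 inner_2)
  have "v $ 1 = (e $ 1 * e $ 1 + e $ 2 * e $ 2) * v $ 1" "v $ 2 = (e $ 1 * e $ 1 + e $ 2 * e $ 2) * v $ 2"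
    using e by simp_all
  then show ?thesis
    by (simp add: vec_eq_iff forall_2 inner_2 algebra_simps)
qed

lemma norm_le_frame_coordinates:
  assumes "norm e = 1"
  shows "norm v \<le> \<bar>e \<bullet> v\<bar> + \<bar>quarter_turn e \<bullet> v\<bar>"
proof -
  have "norm v = norm ((e \<bullet> v) *\<^sub>R e + (quarter_turn e \<bullet> v) *\<^sub>R quarter_turn e)"
    using expand_in_frame[OF assms, of v] by simp
  also have "\<dots> \<le> \<bar>e \<bullet> v\<bar> + \<bar>quarter_turn e \<bullet> v\<bar>"
    using norm_triangle_ineq[of "(e \<bullet> v) *\<^sub>R e" "(quarter_turn e \<bullet> v) *\<^sub>R quarter_turn e"] assms
    by simp
  finally show ?thesis .
qed

lemma abs_inner_unit_le: "norm e = 1 \<Longrightarrow> \<bar>e \<bullet> v\<bar> \<le> norm v" for e v :: "real^2"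
  using Cauchy_Schwarz_ineq2[of e v] by simp

text \<open>Two frames of this kind have the same orientation and differ by a rotation; hence the
  same two numbers, cosine and sine up to sign, serve for both coordinates.\<close>

lemma inner_change_frame:
  assumes "norm e = 1"
  shows "f \<bullet> v = (f \<bullet> e) * (e \<bullet> v) + (f \<bullet> quarter_turn e) * (quarter_turn e \<bullet> v)"
    and "quarter_turn f \<bullet> v
      = - (f \<bullet> quarter_turn e) * (e \<bullet> v) + (f \<bullet> e) * (quarter_turn e \<bullet> v)"
proof -
  have "f \<bullet> v = f \<bullet> ((e \<bullet> v) *\<^sub>R e + (quarter_turn e \<bullet> v) *\<^sub>R quarter_turn e)"
    using expand_in_frame[OF assms, of v] by simp
  then show "f \<bullet> v = (f \<bullet> e) * (e \<bullet> v) + (f \<bullet> quarter_turn e) * (quarter_turn e \<bullet> v)"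
    by (simp add: inner_add_right mult.commute)
  have *: "quarter_turn f \<bullet> e = - (f \<bullet> quarter_turn e)"
    by (simp add: inner_2)
  have "quarter_turn f \<bullet> v
      = quarter_turn f \<bullet> ((e \<bullet> v) *\<^sub>R e + (quarter_turn e \<bullet> v) *\<^sub>R quarter_turn e)"
    using expand_in_frame[OF assms, of v] by simp
  then show "quarter_turn f \<bullet> v
      = - (f \<bullet> quarter_turn e) * (e \<bullet> v) + (f \<bullet> e) * (quarter_turn e \<bullet> v)"
    by (simp add: inner_add_right * mult.commute)
qed

section \<open>Operator norm and singular frames of one matrix\<close>

lemma norm_le_opnorm: "norm (B *v v) \<le> opnorm B * norm v"
  unfolding opnorm_def by (rule onorm) simp

lemma opnorm_le:
  assumes "\<And>v. norm v = 1 \<Longrightarrow> norm (B *v v) \<le> b"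
  shows "opnorm B \<le> b"
  unfolding opnorm_def
proof (rule onorm_le)
  fix v :: "real^2"
  show "norm (B *v v) \<le> b * norm v"
  proof (cases "v = 0")
    case False
    have "norm (B *v ((1 / norm v) *\<^sub>R v)) \<le> b"
      by (rule assms) (use False in simp)
    then show ?thesis
      using False by (simp add: matrix_vector_mult_scaleR field_simps)
  qed simp
qed

lemma opnorm_attained:
  obtains r where "norm r = 1" "norm (B *v r) = opnorm B"
proof -
  have "\<exists>r\<in>sphere (0::real^2) 1. \<forall>v\<in>sphere 0 1. norm (B *v v) \<le> norm (B *v r)"
  proof (rule continuous_attains_sup)
    show "sphere (0::real^2) 1 \<noteq> {}"
      by simp
    show "continuous_on (sphere 0 1) (\<lambda>v. norm (B *v v))"
      by (intro continuous_intros linear_continuous_on) simp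
  qed simp
  then obtain r where r: "norm r = 1" "\<And>v. norm v = 1 \<Longrightarrow> norm (B *v v) \<le> norm (B *v r)"
    by auto
  have "opnorm B \<le> norm (B *v r)"
    by (rule opnorm_le) (rule r)
  with norm_le_opnorm[of B r] r show ?thesis
    using that[of r] by simp
qed

text \<open>First-order condition at a maximum: for \<open>t = b / e\<close> with \<open>e\<close>
  above \<open>\<bar>d\<bar>\<close> the linear term outweighs the quadratic one.\<close>

lemma linear_term_zero:
  fixes b :: real
  assumes "\<And>t. 2 * t * b + t\<^sup>2 * d \<le> 0"
  shows "b = 0"
proof (rule ccontr)
  assume "b \<noteq> 0"
  define e where "e = \<bar>d\<bar> + 1"
  have e: "e > 0" "d \<ge> - e" by (auto simp: e_def)
  have "2 * (b / e) * b + (b / e)\<^sup>2 * d \<ge> 2 * (b / e) * b + (b / e)\<^sup>2 * (- e)"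
    using e by (intro add_left_mono mult_left_mono) auto
  moreover have "2 * (b / e) * b + (b / e)\<^sup>2 * (- e) = b\<^sup>2 / e"
    using e by (simp add: field_simps power2_eq_square)
  moreover have "b\<^sup>2 / e > 0" using e \<open>b \<noteq> 0\<close> by simp
  ultimately show False using assms[of "b / e"] by linarith
qed

text \<open>A singular value decomposition. Since \<open>r\<close> maximises the stretching,
  perturbing it along \<open>quarter_turn r\<close> shows that the images of \<open>r\<close> and
  \<open>quarter_turn r\<close> are orthogonal. Preservation of area then fixes the length and the
  orientation of the second image.\<close>

lemma SL2_singular_frame:
  assumes "B \<in> SL2"
  obtains r u where "norm r = 1" "norm u = 1" "B *v r = opnorm B *\<^sub>R u"
    "B *v quarter_turn r = (1 / opnorm B) *\<^sub>R quarter_turn u" "opnorm B > 0"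
proof -
  have det: "det B = 1" using assms by (simp add: SL2_def)
  obtain r where r: "norm r = 1" "norm (B *v r) = opnorm B"
    by (rule opnorm_attained)
  have rr: "r \<bullet> r = 1" using r by (simp add: norm_eq_1)
  have vol: "quarter_turn (B *v r) \<bullet> (B *v quarter_turn r) = 1"
    using rr by (simp only: inner_quarter_turn_matrix det) simp
  have "B *v r \<noteq> 0"
  proof
    assume "B *v r = 0"
    with vol show False by (simp add: inner_2)
  qed
  then have pos: "opnorm B > 0" using r by (metis zero_less_norm_iff)
  have sq: "(norm v)\<^sup>2 = v \<bullet> v" for v :: "real^2"
    by (simp add: power2_norm_eq_inner)
  have ortho: "(B *v r) \<bullet> (B *v quarter_turn r) = 0"
  proof (rule linear_term_zero)
    fix t :: real
    have "(norm (B *v (r + t *\<^sub>R quarter_turn r)))\<^sup>2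
        \<le> (opnorm B * norm (r + t *\<^sub>R quarter_turn r))\<^sup>2"
      by (intro power_mono norm_le_opnorm) simp
    also have "\<dots> = (opnorm B)\<^sup>2 * (1 + t\<^sup>2)"
      unfolding power_mult_distrib sq
      by (simp add: inner_add_left inner_add_right rr power2_eq_square)
    finally have "(norm (B *v (r + t *\<^sub>R quarter_turn r)))\<^sup>2 \<le> (opnorm B)\<^sup>2 * (1 + t\<^sup>2)" .
    moreover have "(norm (B *v (r + t *\<^sub>R quarter_turn r)))\<^sup>2
        = (norm (B *v r))\<^sup>2 + 2 * t * ((B *v r) \<bullet> (B *v quarter_turn r))
          + t\<^sup>2 * (norm (B *v quarter_turn r))\<^sup>2"
      unfolding sq matrix_vector_right_distrib matrix_vector_mult_scaleR
      by (simp add: inner_add_left inner_add_right inner_commute power2_eq_square algebra_simps)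
    ultimately show "2 * t * ((B *v r) \<bullet> (B *v quarter_turn r))
        + t\<^sup>2 * ((norm (B *v quarter_turn r))\<^sup>2 - (opnorm B)\<^sup>2) \<le> 0"
      using r by (simp add: algebra_simps)
  qed
  define u where "u = (1 / opnorm B) *\<^sub>R (B *v r)"
  have u: "norm u = 1" "B *v r = opnorm B *\<^sub>R u"
    using pos r by (simp_all add: u_def)
  have "u \<bullet> (B *v quarter_turn r) = 0"
    using ortho by (simp add: u_def)
  moreover have "quarter_turn u \<bullet> (B *v quarter_turn r) = 1 / opnorm B"
    using vol by (simp add: u_def)
  ultimately have "B *v quarter_turn r = (1 / opnorm B) *\<^sub>R quarter_turn u"
    using expand_in_frame[OF u(1), of "B *v quarter_turn r"] by simp
  with r u pos that show ?thesis by blast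
qed

lemma singular_frame_coordinates:
  assumes r: "norm r = 1" and u: "norm u = 1" and stretch: "B *v r = a *\<^sub>R u"
    and shrink: "B *v quarter_turn r = (1 / a) *\<^sub>R quarter_turn u"
  shows "u \<bullet> (B *v v) = a * (r \<bullet> v)"
    and "quarter_turn u \<bullet> (B *v v) = (quarter_turn r \<bullet> v) / a"
proof -
  have "B *v v = B *v ((r \<bullet> v) *\<^sub>R r + (quarter_turn r \<bullet> v) *\<^sub>R quarter_turn r)"
    using expand_in_frame[OF r, of v] by simp
  also have "\<dots> = (a * (r \<bullet> v)) *\<^sub>R u + ((quarter_turn r \<bullet> v) / a) *\<^sub>R quarter_turn u"
    by (simp add: matrix_vector_right_distrib matrix_vector_mult_scaleR stretch shrink mult.commute)
  finally have eq: "B *v v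
      = (a * (r \<bullet> v)) *\<^sub>R u + ((quarter_turn r \<bullet> v) / a) *\<^sub>R quarter_turn u" .
  have "u \<bullet> u = 1" using u by (simp add: norm_eq_1)
  then show "u \<bullet> (B *v v) = a * (r \<bullet> v)"
    "quarter_turn u \<bullet> (B *v v) = (quarter_turn r \<bullet> v) / a"
    unfolding eq by (simp_all add: inner_add_right)
qed

text \<open>In the frames the norm of the product is at most
  \<open>a * a' * \<bar>r' \<bullet> u\<bar>\<close> plus the errors \<open>a' / a\<close>,
  \<open>a / a'\<close> and \<open>1 / (a * a')\<close>. Each error is at most a sixth of
  \<open>a * a' / L\<close>, so at least half of the lower bound \<open>product\<close> must come
  from the angle.\<close>

lemma transversality_of_opnorm_product:
  assumes B: "norm r = 1" "norm u = 1" "B *v r = a *\<^sub>R u"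
      "B *v quarter_turn r = (1 / a) *\<^sub>R quarter_turn u"
    and B': "norm r' = 1" "norm u' = 1" "B' *v r' = a' *\<^sub>R u'"
      "B' *v quarter_turn r' = (1 / a') *\<^sub>R quarter_turn u'"
    and L: "L \<ge> 100" and a: "a \<ge> L\<^sup>2" "a' \<ge> L\<^sup>2"
    and product: "a * a' / L \<le> opnorm (B' ** B)"
  shows "1 / (2 * L) \<le> \<bar>r' \<bullet> u\<bar>"
proof -
  have L2: "L\<^sup>2 \<ge> 100 * L" using L by (simp add: power2_eq_square)
  have big: "a \<ge> 6 * L" "a' \<ge> 6 * L" "a \<ge> 1" "a' \<ge> 1" using a L2 L by auto
  have sq: "6 * L \<le> t * t" if "6 * L \<le> t" "1 \<le> t" for t :: real
    using mult_left_mono[of 1 t t] that by linarith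
  have div_le: "s / t \<le> s * t / (6 * L)" if "6 * L \<le> t" "1 \<le> t" "s \<ge> 0" for s t :: real
  proof -
    have "s * (6 * L) \<le> s * (t * t)" using sq that by (intro mult_left_mono) auto
    then show ?thesis using that L by (simp add: field_simps)
  qed
  have "opnorm (B' ** B) \<le> a' * (\<bar>r' \<bullet> u\<bar> * a + 1 / a) + (a + 1 / a) / a'"
  proof (rule opnorm_le)
    fix v :: "real^2" assume v: "norm v = 1"
    let ?w = "B *v v"
    have x: "\<bar>u \<bullet> ?w\<bar> \<le> a"
      using abs_inner_unit_le[OF B(1), of v] v big
      by (simp add: singular_frame_coordinates(1)[OF B] abs_mult)
    have y: "\<bar>quarter_turn u \<bullet> ?w\<bar> \<le> 1 / a"
      using abs_inner_unit_le[of "quarter_turn r" v] B(1) v big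
      by (simp add: singular_frame_coordinates(2)[OF B] divide_right_mono)
    have q: "\<bar>r' \<bullet> quarter_turn u\<bar> \<le> 1" and p: "\<bar>r' \<bullet> u\<bar> \<le> 1"
      using abs_inner_unit_le[OF B'(1), of "quarter_turn u"] abs_inner_unit_le[OF B'(1), of u] B(2)
      by simp_all
    have "\<bar>r' \<bullet> ?w\<bar> \<le> \<bar>r' \<bullet> u\<bar> * \<bar>u \<bullet> ?w\<bar> + \<bar>r' \<bullet> quarter_turn u\<bar> * \<bar>quarter_turn u \<bullet> ?w\<bar>"
      unfolding inner_change_frame(1)[OF B(2), of r' ?w]
      by (rule order_trans[OF abs_triangle_ineq]) (simp add: abs_mult)
    also have "\<dots> \<le> \<bar>r' \<bullet> u\<bar> * a + 1 * (1 / a)"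
      using x y q by (intro add_mono mult_mono) auto
    finally have 1: "\<bar>r' \<bullet> ?w\<bar> \<le> \<bar>r' \<bullet> u\<bar> * a + 1 / a" by simp
    have "\<bar>quarter_turn r' \<bullet> ?w\<bar>
        \<le> \<bar>r' \<bullet> quarter_turn u\<bar> * \<bar>u \<bullet> ?w\<bar> + \<bar>r' \<bullet> u\<bar> * \<bar>quarter_turn u \<bullet> ?w\<bar>"
      unfolding inner_change_frame(2)[OF B(2), of r' ?w]
      by (rule order_trans[OF abs_triangle_ineq]) (simp add: abs_mult)
    also have "\<dots> \<le> 1 * a + 1 * (1 / a)"
      using x y q p by (intro add_mono mult_mono) auto
    finally have 2: "\<bar>quarter_turn r' \<bullet> ?w\<bar> \<le> a + 1 / a" by simp
    have "norm (B' *v ?w) \<le> \<bar>u' \<bullet> (B' *v ?w)\<bar> + \<bar>quarter_turn u' \<bullet> (B' *v ?w)\<bar>"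
      by (rule norm_le_frame_coordinates) (rule B'(2))
    also have "\<dots> = a' * \<bar>r' \<bullet> ?w\<bar> + \<bar>quarter_turn r' \<bullet> ?w\<bar> / a'"
      using big by (simp add: singular_frame_coordinates[OF B'] abs_mult)
    also have "\<dots> \<le> a' * (\<bar>r' \<bullet> u\<bar> * a + 1 / a) + (a + 1 / a) / a'"
      using 1 2 big by (intro add_mono mult_left_mono divide_right_mono) auto
    finally show "norm ((B' ** B) *v v) \<le> a' * (\<bar>r' \<bullet> u\<bar> * a + 1 / a) + (a + 1 / a) / a'"
      by (simp add: matrix_vector_mul_assoc)
  qed
  also have "\<dots> = a * a' * \<bar>r' \<bullet> u\<bar> + a' / a + a / a' + 1 / (a * a')"
    by (simp add: algebra_simps add_divide_distrib)
  also have "\<dots> \<le> a * a' * \<bar>r' \<bullet> u\<bar> + a * a' / (6 * L) + a * a' / (6 * L) + a * a' / (6 * L)"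
  proof (intro add_mono)
    show "a' / a \<le> a * a' / (6 * L)" "a / a' \<le> a * a' / (6 * L)"
      using div_le[of a a'] div_le[of a' a] big by (simp_all add: mult.commute)
    have "6 * L * 1 \<le> a * a'" using big L by (intro mult_mono) auto
    moreover from this have "1 \<le> a * a'" using L by linarith
    ultimately show "1 / (a * a') \<le> a * a' / (6 * L)"
      using div_le[of "a * a'" 1] by simp
  qed simp
  finally have "a * a' / L \<le> a * a' * \<bar>r' \<bullet> u\<bar> + 3 * (a * a' / (6 * L))"
    using product by simp
  also have "3 * (a * a' / (6 * L)) = a * a' / (2 * L)" by simp
  finally have "a * a' * (1 / (2 * L)) \<le> a * a' * \<bar>r' \<bullet> u\<bar>"
    using L by (simp add: field_simps)
  moreover have "a * a' > 0" using big by simp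
  ultimately show ?thesis by (rule mult_left_le_imp_le)
qed

section \<open>Inverses, iterates and bounded orbits\<close>

lemma SL2_invertible: "B \<in> SL2 \<Longrightarrow> invertible B"
  by (simp add: SL2_def invertible_det_nz)

lemma matrix_inv_inverse:
  fixes B :: "real^'n^'n"
  assumes "invertible B"
  shows "B ** matrix_inv B = mat 1" "matrix_inv B ** B = mat 1"
  using someI_ex[OF assms[unfolded invertible_def]] by (simp_all add: matrix_inv_def)

lemma matrix_inv_mult_vec:
  assumes "B \<in> SL2"
  shows "matrix_inv B *v (B *v v) = v" "B *v (matrix_inv B *v v) = v"
  using matrix_inv_inverse[OF SL2_invertible[OF assms]] by (simp_all add: matrix_vector_mul_assoc)

lemma matrix_inv_SL2:
  assumes "B \<in> SL2"
  shows "matrix_inv B \<in> SL2"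
proof -
  have "det (B ** matrix_inv B) = 1"
    using matrix_inv_inverse[OF SL2_invertible[OF assms]] by simp
  then show ?thesis using assms by (simp add: SL2_def det_mul)
qed

lemma forward_iter_shift: "forward_iter A (Suc n) j = forward_iter A n (j + 1) ** A j"
proof (induction n)
  case (Suc n)
  have "forward_iter A (Suc (Suc n)) j = A (j + int (Suc n)) ** forward_iter A (Suc n) j"
    by simp
  also have "\<dots> = A (j + int (Suc n)) ** (forward_iter A n (j + 1) ** A j)"
    by (simp only: Suc)
  also have "j + int (Suc n) = (j + 1) + int n" by simp
  finally show ?case by (simp add: matrix_mul_assoc)
qed simp

lemma forward_iter_Suc_vec:
  "forward_iter A (Suc n) j *v v = A (j + int n) *v (forward_iter A n j *v v)"
  by (simp add: matrix_vector_mul_assoc)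

lemma forward_iter_shift_vec:
  "forward_iter A (Suc n) j *v v = forward_iter A n (j + 1) *v (A j *v v)"
  by (simp only: forward_iter_shift matrix_vector_mul_assoc)

lemma forward_iter_add_vec:
  "forward_iter A (m + n) j *v v = forward_iter A n (j + int m) *v (forward_iter A m j *v v)"
  by (induction n) (simp_all add: forward_iter_Suc_vec algebra_simps del: forward_iter.simps(2))

lemma forward_iter_SL2: "(\<And>j. A j \<in> SL2) \<Longrightarrow> forward_iter A n j \<in> SL2"
  by (induction n) (simp_all add: SL2_def det_mul)

text \<open>Boundedness is used instead of decay because linearity and invariance then need no
  estimates; \<open>bounded_orbit_decay\<close> recovers the decay.\<close>

definition bounded_orbits :: "(int \<Rightarrow> real^2^2) \<Rightarrow> int \<Rightarrow> (real^2) set" where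
  "bounded_orbits A j = {v. \<exists>b. \<forall>n. norm (forward_iter A n j *v v) \<le> b}"

lemma subspace_bounded_orbits: "subspace (bounded_orbits A j)"
proof (rule subspaceI)
  show "0 \<in> bounded_orbits A j"
    by (auto simp: bounded_orbits_def)
next
  fix v w assume "v \<in> bounded_orbits A j" "w \<in> bounded_orbits A j"
  then obtain b b' where "\<And>n. norm (forward_iter A n j *v v) \<le> b"
    "\<And>n. norm (forward_iter A n j *v w) \<le> b'"
    by (auto simp: bounded_orbits_def)
  then have "norm (forward_iter A n j *v (v + w)) \<le> b + b'" for n
    unfolding matrix_vector_right_distrib by (meson norm_triangle_mono)
  then show "v + w \<in> bounded_orbits A j"
    by (auto simp: bounded_orbits_def)
next
  fix t v assume "v \<in> bounded_orbits A j"
  then obtain b where "\<And>n. norm (forward_iter A n j *v v) \<le> b"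
    by (auto simp: bounded_orbits_def)
  then have "norm (forward_iter A n j *v (t *\<^sub>R v)) \<le> \<bar>t\<bar> * b" for n
    by (simp add: matrix_vector_mult_scaleR mult_left_mono)
  then show "t *\<^sub>R v \<in> bounded_orbits A j"
    by (auto simp: bounded_orbits_def)
qed

lemma bounded_orbits_invariant_iff:
  "A j *v v \<in> bounded_orbits A (j + 1) \<longleftrightarrow> v \<in> bounded_orbits A j"
proof
  assume "A j *v v \<in> bounded_orbits A (j + 1)"
  then obtain b where b: "\<And>n. norm (forward_iter A n (j + 1) *v (A j *v v)) \<le> b"
    by (auto simp: bounded_orbits_def)
  have "norm (forward_iter A n j *v v) \<le> max b (norm v)" for n
  proof (cases n)
    case (Suc m)
    then show ?thesis
      using b[of m] by (simp add: forward_iter_shift_vec max.coboundedI1 del: forward_iter.simps(2))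
  qed simp
  then show "v \<in> bounded_orbits A j"
    by (auto simp: bounded_orbits_def)
next
  assume "v \<in> bounded_orbits A j"
  then obtain b where "\<And>n. norm (forward_iter A n j *v v) \<le> b"
    by (auto simp: bounded_orbits_def)
  then have "norm (forward_iter A n (j + 1) *v (A j *v v)) \<le> b" for n
    by (metis forward_iter_shift_vec)
  then show "A j *v v \<in> bounded_orbits A (j + 1)"
    by (auto simp: bounded_orbits_def)
qed

lemma proj_act_bounded_orbits:
  assumes "A j \<in> SL2"
  shows "proj_act (A j) (bounded_orbits A j) = bounded_orbits A (j + 1)"
proof
  show "proj_act (A j) (bounded_orbits A j) \<subseteq> bounded_orbits A (j + 1)"
    by (auto simp: proj_act_def bounded_orbits_invariant_iff)
  show "bounded_orbits A (j + 1) \<subseteq> proj_act (A j) (bounded_orbits A j)"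
  proof
    fix w assume w: "w \<in> bounded_orbits A (j + 1)"
    have eq: "w = A j *v (matrix_inv (A j) *v w)"
      by (simp add: matrix_inv_mult_vec[OF assms])
    then have "matrix_inv (A j) *v w \<in> bounded_orbits A j"
      using w by (metis bounded_orbits_invariant_iff)
    with eq show "w \<in> proj_act (A j) (bounded_orbits A j)"
      unfolding proj_act_def by blast
  qed
qed


section \<open>One-step cone estimates\<close>

locale singular_frames =
  fixes A :: "int \<Rightarrow> real^2^2" and a :: "int \<Rightarrow> real" and r u :: "int \<Rightarrow> real^2" and L :: real
  assumes L_ge: "L \<ge> 100"
    and SL2: "A j \<in> SL2"
    and r_unit: "norm (r j) = 1"
    and u_unit: "norm (u j) = 1"
    and a_ge: "a j \<ge> L\<^sup>2"
    and stretch: "A j *v r j = a j *\<^sub>R u j"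
    and shrink: "A j *v quarter_turn (r j) = (1 / a j) *\<^sub>R quarter_turn (u j)"
    and transversal: "\<bar>r (j + 1) \<bullet> u j\<bar> \<ge> 1 / (2 * L)"
begin

definition X :: "int \<Rightarrow> real^2 \<Rightarrow> real" where
  "X j v = u j \<bullet> v"

definition Y :: "int \<Rightarrow> real^2 \<Rightarrow> real" where
  "Y j v = quarter_turn (u j) \<bullet> v"

text \<open>The cosine of the angle between the line of \<open>u j\<close>, into which
  \<open>A j\<close> stretches, and the line most expanded by \<open>A (j + 1)\<close>.\<close>

definition c :: "int \<Rightarrow> real" where
  "c j = \<bar>r (j + 1) \<bullet> u j\<bar>"

lemma L_pos: "L > 0"
  using L_ge by simp

lemma a_pos: "a j > 0"
  using a_ge[of j] L_pos by (meson less_le_trans zero_less_power)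

lemma c_ge: "c j \<ge> 1 / (2 * L)"
  using transversal by (simp add: c_def)

lemma c_pos: "c j > 0"
  using c_ge[of j] L_pos by (meson less_le_trans zero_less_divide_1_iff zero_less_mult_iff zero_less_numeral)

lemma abs_X_le: "\<bar>X j v\<bar> \<le> norm v"
  unfolding X_def by (rule abs_inner_unit_le) (rule u_unit)

lemma norm_le_X_Y: "norm v \<le> \<bar>X j v\<bar> + \<bar>Y j v\<bar>"
  unfolding X_def Y_def by (rule norm_le_frame_coordinates) (rule u_unit)

lemma X_apply: "X j (A j *v v) = a j * (r j \<bullet> v)"
  and Y_apply: "Y j (A j *v v) = (quarter_turn (r j) \<bullet> v) / a j"
  unfolding X_def Y_def by (rule singular_frame_coordinates[OF r_unit u_unit stretch shrink])+

text \<open>One step is a rotation with entries \<open>p\<close>, \<open>q\<close> followed by the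
  diagonal map with entries \<open>a (j + 1)\<close> and its inverse. The entry \<open>p\<close> is
  kept as \<open>c j\<close> where it multiplies \<open>X\<close> in the expanded coordinate, since
  it belongs to the main term; elsewhere \<open>p\<close> and \<open>q\<close> are bounded by
  1.\<close>

lemma step_estimates:
  fixes j v
  defines "v' \<equiv> A (j + 1) *v v"
  shows "\<bar>X (j + 1) v'\<bar> \<le> a (j + 1) * (c j * \<bar>X j v\<bar> + \<bar>Y j v\<bar>)"
    and "a (j + 1) * (c j * \<bar>X j v\<bar> - \<bar>Y j v\<bar>) \<le> \<bar>X (j + 1) v'\<bar>"
    and "\<bar>Y (j + 1) v'\<bar> \<le> (\<bar>X j v\<bar> + \<bar>Y j v\<bar>) / L\<^sup>2"
proof -
  define p q where "p = r (j + 1) \<bullet> u j" and "q = r (j + 1) \<bullet> quarter_turn (u j)"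
  have cp: "c j = \<bar>p\<bar>" by (simp add: c_def p_def)
  have p1: "\<bar>p\<bar> \<le> 1"
    using abs_inner_unit_le[OF r_unit, of "j + 1" "u j"] by (simp add: p_def u_unit)
  have q1: "\<bar>q\<bar> \<le> 1"
    using abs_inner_unit_le[OF r_unit, of "j + 1" "quarter_turn (u j)"] by (simp add: q_def u_unit)
  have X': "X (j + 1) v' = a (j + 1) * (p * X j v + q * Y j v)"
    unfolding v'_def X_apply
    using inner_change_frame(1)[OF u_unit, of "r (j + 1)" v j] by (simp add: p_def q_def X_def Y_def)
  have Y': "Y (j + 1) v' = (- q * X j v + p * Y j v) / a (j + 1)"
    unfolding v'_def Y_apply
    using inner_change_frame(2)[OF u_unit, of "r (j + 1)" v j] by (simp add: p_def q_def X_def Y_def)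
  have qY: "\<bar>q * Y j v\<bar> \<le> \<bar>Y j v\<bar>" and qX: "\<bar>q * X j v\<bar> \<le> \<bar>X j v\<bar>"
    and pY: "\<bar>p * Y j v\<bar> \<le> \<bar>Y j v\<bar>"
    using q1 p1 by (simp_all add: abs_mult mult_left_le_one_le)
  have absX: "\<bar>X (j + 1) v'\<bar> = a (j + 1) * \<bar>p * X j v + q * Y j v\<bar>"
    using a_pos[of "j + 1"] by (simp add: X' abs_mult)
  have cX: "c j * \<bar>X j v\<bar> = \<bar>p * X j v\<bar>" by (simp add: cp abs_mult)
  show "\<bar>X (j + 1) v'\<bar> \<le> a (j + 1) * (c j * \<bar>X j v\<bar> + \<bar>Y j v\<bar>)"
    unfolding absX cX using a_pos[of "j + 1"] qY by (intro mult_left_mono) linarith+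
  show "a (j + 1) * (c j * \<bar>X j v\<bar> - \<bar>Y j v\<bar>) \<le> \<bar>X (j + 1) v'\<bar>"
    unfolding absX cX using a_pos[of "j + 1"] qY by (intro mult_left_mono) linarith+
  have "\<bar>Y (j + 1) v'\<bar> = \<bar>- q * X j v + p * Y j v\<bar> / a (j + 1)"
    using a_pos[of "j + 1"] by (simp add: Y')
  also have "\<dots> \<le> (\<bar>X j v\<bar> + \<bar>Y j v\<bar>) / a (j + 1)"
    using a_pos[of "j + 1"] qX pY by (intro divide_right_mono) auto
  also have "\<dots> \<le> (\<bar>X j v\<bar> + \<bar>Y j v\<bar>) / L\<^sup>2"
    using a_ge[of "j + 1"] a_pos[of "j + 1"] L_pos by (intro divide_left_mono) auto
  finally show "\<bar>Y (j + 1) v'\<bar> \<le> (\<bar>X j v\<bar> + \<bar>Y j v\<bar>) / L\<^sup>2" .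
qed

text \<open>The slope \<open>1 / (8 * L)\<close> uses up a quarter of the bound
  \<open>1 / (2 * L)\<close> for \<open>c j\<close>. The remaining \<open>3 / (8 * L)\<close>,
  multiplied by \<open>a (j + 1) \<ge> L\<^sup>2\<close>, expands \<open>X\<close> by
  \<open>3 * L / 8\<close>, while \<open>Y\<close> becomes of order
  \<open>X / L\<^sup>2\<close>.\<close>

lemma cone_step:
  assumes "\<bar>Y j v\<bar> \<le> \<bar>X j v\<bar> / (8 * L)"
  shows "2 * \<bar>X j v\<bar> \<le> \<bar>X (j + 1) (A (j + 1) *v v)\<bar>" (is ?grow)
    and "\<bar>Y (j + 1) (A (j + 1) *v v)\<bar> \<le> 6 / L^3 * \<bar>X (j + 1) (A (j + 1) *v v)\<bar>" (is ?narrow)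
proof -
  let ?x = "\<bar>X j v\<bar>" and ?v = "A (j + 1) *v v"
  have "3 / (8 * L) * ?x = 1 / (2 * L) * ?x - ?x / (8 * L)"
    using L_pos by (simp add: field_simps)
  also have "\<dots> \<le> c j * ?x - \<bar>Y j v\<bar>"
    using assms by (intro diff_mono mult_right_mono c_ge) auto
  finally have 1: "3 / (8 * L) * ?x \<le> c j * ?x - \<bar>Y j v\<bar>" .
  have "3 * L / 8 * ?x = L\<^sup>2 * (3 / (8 * L) * ?x)"
    using L_pos by (simp add: power2_eq_square)
  also have "\<dots> \<le> a (j + 1) * (c j * ?x - \<bar>Y j v\<bar>)"
    using 1 L_pos by (intro mult_mono a_ge) (auto intro: less_imp_le[OF a_pos])
  also note step_estimates(2)
  finally have 2: "3 * L / 8 * ?x \<le> \<bar>X (j + 1) ?v\<bar>" .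
  have "2 * ?x \<le> 3 * L / 8 * ?x"
    using L_ge by (intro mult_right_mono) auto
  with 2 show ?grow by simp
  have "?x / (8 * L) \<le> ?x / 1"
    using L_ge by (intro divide_left_mono) auto
  then have "\<bar>Y j v\<bar> \<le> ?x" using assms by simp
  \<comment> \<open>The factor \<open>9 / 4\<close> is rounded up so that division by
    \<open>3 * L / 8\<close> gives exactly the slope \<open>6 / L^3\<close>.\<close>
  then have "(?x + \<bar>Y j v\<bar>) / L\<^sup>2 \<le> (9 / 4 * ?x) / L\<^sup>2"
    by (intro divide_right_mono) auto
  also have "\<dots> = 6 / L^3 * (3 * L / 8 * ?x)"
    using L_pos by (simp add: field_simps power2_eq_square power3_eq_cube)
  also have "\<dots> \<le> 6 / L^3 * \<bar>X (j + 1) ?v\<bar>"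
    using 2 L_pos by (intro mult_left_mono) auto
  finally show ?narrow using step_estimates(3)[of j v] by linarith
qed

lemma narrow_le_wide: "6 / L^3 < 1 / (8 * L)"
proof -
  have "48 < L * L"
    using mult_mono[OF L_ge L_ge] L_pos by simp
  then show ?thesis
    using L_pos by (simp add: field_simps power3_eq_cube)
qed

lemma narrow_cone_in_wide_cone:
  assumes "\<bar>y\<bar> \<le> 6 / L^3 * \<bar>x\<bar>"
  shows "\<bar>y\<bar> \<le> \<bar>x\<bar> / (8 * L)"
proof -
  have "6 / L^3 * \<bar>x\<bar> \<le> 1 / (8 * L) * \<bar>x\<bar>"
    using narrow_le_wide by (intro mult_right_mono) auto
  with assms show ?thesis by simp
qed

text \<open>Because \<open>c j \<ge> 1 / (2 * L)\<close>, the slope \<open>6 / L^3\<close> makes the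
  contribution of \<open>Y\<close> a relative error of at most \<open>12 / L\<^sup>2\<close> against
  \<open>c j * \<bar>X j v\<bar>\<close>.\<close>

lemma narrow_cone_step:
  assumes "\<bar>Y j v\<bar> \<le> 6 / L^3 * \<bar>X j v\<bar>"
  shows "a (j + 1) * c j * (1 - 12 / L\<^sup>2) * \<bar>X j v\<bar> \<le> \<bar>X (j + 1) (A (j + 1) *v v)\<bar>"
proof -
  have "6 / L^3 * \<bar>X j v\<bar> = 12 / L\<^sup>2 * (1 / (2 * L)) * \<bar>X j v\<bar>"
    using L_pos by (simp add: field_simps power2_eq_square power3_eq_cube)
  also have "\<dots> \<le> 12 / L\<^sup>2 * c j * \<bar>X j v\<bar>"
    by (intro mult_right_mono mult_left_mono c_ge) auto
  finally have "\<bar>Y j v\<bar> \<le> 12 / L\<^sup>2 * c j * \<bar>X j v\<bar>" using assms by linarith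
  then have "c j * (1 - 12 / L\<^sup>2) * \<bar>X j v\<bar> \<le> c j * \<bar>X j v\<bar> - \<bar>Y j v\<bar>"
    by (simp add: algebra_simps)
  then have "a (j + 1) * (c j * (1 - 12 / L\<^sup>2) * \<bar>X j v\<bar>) \<le> a (j + 1) * (c j * \<bar>X j v\<bar> - \<bar>Y j v\<bar>)"
    by (rule mult_left_mono) (rule less_imp_le[OF a_pos])
  then show ?thesis using step_estimates(2)[of j v] by (simp add: mult.assoc)
qed

text \<open>The two bounds say that the norm \<open>max \<bar>X\<bar> (L^3 / 6 * \<bar>Y\<bar>)\<close> grows by at most the
  given factor; they hold for all vectors, also those outside the cones.\<close>

lemma adapted_norm_step:
  assumes "\<bar>X j v\<bar> \<le> z" "\<bar>Y j v\<bar> \<le> 6 / L^3 * z"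
  shows "\<bar>X (j + 1) (A (j + 1) *v v)\<bar> \<le> a (j + 1) * c j * (1 + 12 / L\<^sup>2) * z" (is ?X)
    and "\<bar>Y (j + 1) (A (j + 1) *v v)\<bar> \<le> 6 / L^3 * (a (j + 1) * c j * (1 + 12 / L\<^sup>2) * z)" (is ?Y)
proof -
  have z: "z \<ge> 0" using assms(1) by linarith
  have "6 / L^3 * z = 12 / L\<^sup>2 * (1 / (2 * L)) * z"
    using L_pos by (simp add: field_simps power2_eq_square power3_eq_cube)
  also have "\<dots> \<le> 12 / L\<^sup>2 * c j * z"
    using z by (intro mult_right_mono mult_left_mono c_ge) auto
  finally have y: "\<bar>Y j v\<bar> \<le> 12 / L\<^sup>2 * c j * z" using assms by linarith
  have "c j * \<bar>X j v\<bar> \<le> c j * z"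
    using assms c_pos[of j] by (intro mult_left_mono) auto
  with y have "c j * \<bar>X j v\<bar> + \<bar>Y j v\<bar> \<le> c j * (1 + 12 / L\<^sup>2) * z"
    by (simp add: algebra_simps)
  then have "a (j + 1) * (c j * \<bar>X j v\<bar> + \<bar>Y j v\<bar>) \<le> a (j + 1) * (c j * (1 + 12 / L\<^sup>2) * z)"
    by (rule mult_left_mono) (rule less_imp_le[OF a_pos])
  then show ?X using step_estimates(1)[of j v] by (simp add: mult.assoc)
  have "6 / L^3 \<le> 1"
    using L_ge power_mono[of 100 L 3] by (simp add: field_simps)
  then have "6 / L^3 * z \<le> 1 * z" using z by (intro mult_right_mono)
  then have "(\<bar>X j v\<bar> + \<bar>Y j v\<bar>) / L\<^sup>2 \<le> (3 * z) / L\<^sup>2"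
    using assms z by (intro divide_right_mono) auto
  \<comment> \<open>The product \<open>L\<^sup>2 * (1 / (2 * L))\<close> is the lower bound for
    \<open>a (j + 1) * c j\<close>.\<close>
  also have "\<dots> = 6 / L^3 * (L\<^sup>2 * (1 / (2 * L)) * 1 * z)"
    using L_pos by (simp add: field_simps power2_eq_square power3_eq_cube)
  also have "\<dots> \<le> 6 / L^3 * (a (j + 1) * c j * (1 + 12 / L\<^sup>2) * z)"
    using z L_pos a_pos[of "j + 1"] c_pos[of j]
    by (intro mult_left_mono mult_right_mono mult_mono a_ge c_ge) auto
  finally show ?Y using step_estimates(3)[of j v] by linarith
qed

section \<open>Growth along orbits and the norm of the iterates\<close>

lemma forward_iter_step_vec:
  "forward_iter A (Suc n) (j + 1) *v v = A (j + int n + 1) *v (forward_iter A n (j + 1) *v v)"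
  by (simp add: forward_iter_Suc_vec algebra_simps del: forward_iter.simps(2))

text \<open>The frame with index \<open>j\<close> is the image frame of \<open>A j\<close>, so the
  next matrix to act on a vector measured in it is \<open>A (j + 1)\<close>; this is the shift
  between \<open>j\<close> and \<open>j + 1\<close> here and below.\<close>

lemma cone_growth:
  assumes "\<bar>Y j v\<bar> \<le> \<bar>X j v\<bar> / (8 * L)"
  shows "2 ^ n * \<bar>X j v\<bar> \<le> \<bar>X (j + int n) (forward_iter A n (j + 1) *v v)\<bar> \<and>
    \<bar>Y (j + int n) (forward_iter A n (j + 1) *v v)\<bar>
      \<le> \<bar>X (j + int n) (forward_iter A n (j + 1) *v v)\<bar> / (8 * L)"
proof (induction n)
  case (Suc n)
  have j: "j + int (Suc n) = j + int n + 1" by simp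
  show ?case
    unfolding forward_iter_step_vec j
    using Suc cone_step[of "j + int n" "forward_iter A n (j + 1) *v v"] narrow_cone_in_wide_cone
    by (auto simp del: of_nat_Suc)
qed (use assms in auto)

text \<open>A product of \<open>n + 1\<close> matrices has only \<open>n\<close> angles between
  neighbours. The first matrix contributes a bare \<open>a j\<close>, which is kept outside.\<close>

definition main_term :: "int \<Rightarrow> nat \<Rightarrow> real" where
  "main_term j n = (\<Prod>k<n. a (j + int k + 1) * c (j + int k))"

lemma main_term_pos: "main_term j n > 0"
  unfolding main_term_def by (intro prod_pos mult_pos_pos a_pos c_pos)

lemma narrow_cone_growth:
  assumes "\<bar>Y j v\<bar> \<le> 6 / L^3 * \<bar>X j v\<bar>"
  shows "main_term j n * (1 - 12 / L\<^sup>2) ^ n * \<bar>X j v\<bar>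
      \<le> \<bar>X (j + int n) (forward_iter A n (j + 1) *v v)\<bar> \<and>
    \<bar>Y (j + int n) (forward_iter A n (j + 1) *v v)\<bar>
      \<le> 6 / L^3 * \<bar>X (j + int n) (forward_iter A n (j + 1) *v v)\<bar>"
proof (induction n)
  case (Suc n)
  let ?k = "j + int n" and ?w = "forward_iter A n (j + 1) *v v"
  have j: "j + int (Suc n) = ?k + 1" by simp
  have "12 / L\<^sup>2 \<le> 1"
    using L_ge power_mono[of 100 L 2] by (simp add: field_simps)
  then have "a (?k + 1) * c ?k * (1 - 12 / L\<^sup>2) * (main_term j n * (1 - 12 / L\<^sup>2) ^ n * \<bar>X j v\<bar>)
      \<le> a (?k + 1) * c ?k * (1 - 12 / L\<^sup>2) * \<bar>X ?k ?w\<bar>"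
    using Suc a_pos c_pos by (intro mult_left_mono mult_nonneg_nonneg less_imp_le[OF a_pos] less_imp_le[OF c_pos]) auto
  also have "\<dots> \<le> \<bar>X (?k + 1) (A (?k + 1) *v ?w)\<bar>"
    using Suc narrow_cone_step by blast
  finally have "main_term j (Suc n) * (1 - 12 / L\<^sup>2) ^ Suc n * \<bar>X j v\<bar>
      \<le> \<bar>X (?k + 1) (A (?k + 1) *v ?w)\<bar>"
    by (simp add: main_term_def mult_ac)
  moreover have "\<bar>Y (?k + 1) (A (?k + 1) *v ?w)\<bar> \<le> 6 / L^3 * \<bar>X (?k + 1) (A (?k + 1) *v ?w)\<bar>"
    using Suc cone_step(2) narrow_cone_in_wide_cone by blast
  ultimately show ?case
    unfolding forward_iter_step_vec j by blast
qed (use assms in \<open>auto simp: main_term_def\<close>)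

lemma adapted_norm_growth:
  assumes "\<bar>X j v\<bar> \<le> z" "\<bar>Y j v\<bar> \<le> 6 / L^3 * z"
  shows "\<bar>X (j + int n) (forward_iter A n (j + 1) *v v)\<bar> \<le> main_term j n * (1 + 12 / L\<^sup>2) ^ n * z \<and>
    \<bar>Y (j + int n) (forward_iter A n (j + 1) *v v)\<bar>
      \<le> 6 / L^3 * (main_term j n * (1 + 12 / L\<^sup>2) ^ n * z)"
proof (induction n)
  case (Suc n)
  let ?k = "j + int n" and ?w = "forward_iter A n (j + 1) *v v"
  have j: "j + int (Suc n) = ?k + 1" by simp
  have *: "main_term j (Suc n) * (1 + 12 / L\<^sup>2) ^ Suc n * z
      = a (?k + 1) * c ?k * (1 + 12 / L\<^sup>2) * (main_term j n * (1 + 12 / L\<^sup>2) ^ n * z)"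
    by (simp add: main_term_def mult_ac)
  show ?case
    unfolding forward_iter_step_vec j * using adapted_norm_step Suc by blast
qed (use assms in \<open>auto simp: main_term_def\<close>)

text \<open>Upper bound: \<open>A j\<close> maps unit vectors into the ball of radius
  \<open>a j\<close> of the adapted norm, and returning to the Euclidean norm costs at most one more
  factor \<open>1 + 12 / L\<^sup>2\<close>, whence the exponent \<open>Suc n\<close>. Lower bound:
  \<open>A j\<close> maps \<open>r j\<close> onto the axis of the narrow cone.\<close>

lemma opnorm_iter_bounds:
  "opnorm (forward_iter A (Suc n) j) \<le> (1 + 12 / L\<^sup>2) ^ Suc n * (a j * main_term j n)"
  "(1 - 12 / L\<^sup>2) ^ n * (a j * main_term j n) \<le> opnorm (forward_iter A (Suc n) j)"
proof -
  have rr: "r j \<bullet> r j = 1" using r_unit by (simp add: norm_eq_1)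
  have L12: "6 / L^3 \<le> 12 / L\<^sup>2"
    using L_ge by (simp add: field_simps power2_eq_square power3_eq_cube)
  show "opnorm (forward_iter A (Suc n) j) \<le> (1 + 12 / L\<^sup>2) ^ Suc n * (a j * main_term j n)"
  proof (rule opnorm_le)
    fix v :: "real^2" assume v: "norm v = 1"
    have "\<bar>r j \<bullet> v\<bar> \<le> 1"
      using abs_inner_unit_le[OF r_unit, of j v] v by simp
    then have X: "\<bar>X j (A j *v v)\<bar> \<le> a j"
      using a_pos[of j] by (simp add: X_apply abs_mult)
    have "\<bar>Y j (A j *v v)\<bar> = \<bar>quarter_turn (r j) \<bullet> v\<bar> / a j"
      using a_pos[of j] by (simp add: Y_apply)
    also have "\<dots> \<le> 1 / L\<^sup>2"
      using abs_inner_unit_le[of "quarter_turn (r j)" v] r_unit v L_pos a_ge[of j]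
      by (intro frac_le) auto
    also have "\<dots> \<le> 6 / L^3 * L\<^sup>2"
      using L_pos L_ge by (simp add: field_simps power2_eq_square power3_eq_cube)
    also have "\<dots> \<le> 6 / L^3 * a j"
      using L_pos by (intro mult_left_mono a_ge) auto
    finally have Y: "\<bar>Y j (A j *v v)\<bar> \<le> 6 / L^3 * a j" .
    let ?w = "forward_iter A n (j + 1) *v (A j *v v)"
    let ?z = "main_term j n * (1 + 12 / L\<^sup>2) ^ n * a j"
    have z: "?z \<ge> 0"
      using main_term_pos[of j n] a_pos[of j] by simp
    have "norm ?w \<le> ?z + 6 / L^3 * ?z"
      using adapted_norm_growth[OF X Y, of n] norm_le_X_Y[of ?w "j + int n"] by linarith
    also have "\<dots> \<le> ?z + 12 / L\<^sup>2 * ?z"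
      using z L12 by (intro add_left_mono mult_right_mono)
    finally show "norm (forward_iter A (Suc n) j *v v) \<le> (1 + 12 / L\<^sup>2) ^ Suc n * (a j * main_term j n)"
      unfolding forward_iter_shift_vec by (simp add: algebra_simps)
  qed
  have X: "X j (A j *v r j) = a j" and Y: "Y j (A j *v r j) = 0"
    by (simp_all add: X_apply Y_apply rr)
  let ?w = "forward_iter A n (j + 1) *v (A j *v r j)"
  have "main_term j n * (1 - 12 / L\<^sup>2) ^ n * \<bar>X j (A j *v r j)\<bar> \<le> \<bar>X (j + int n) ?w\<bar>"
    using narrow_cone_growth[of j "A j *v r j" n] L_pos by (simp add: Y)
  also have "\<dots> \<le> norm ?w" by (rule abs_X_le)
  also have "\<dots> = norm (forward_iter A (Suc n) j *v r j)" by (simp only: forward_iter_shift_vec)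
  also have "\<dots> \<le> opnorm (forward_iter A (Suc n) j)"
    using norm_le_opnorm[of "forward_iter A (Suc n) j" "r j"] by (simp only: r_unit)
  finally show "(1 - 12 / L\<^sup>2) ^ n * (a j * main_term j n) \<le> opnorm (forward_iter A (Suc n) j)"
    using a_pos[of j] by (simp add: X mult_ac)
qed

text \<open>Both \<open>ln (1 + d)\<close> and \<open>ln (1 - d)\<close> have absolute value at most
  \<open>2 * d\<close> for \<open>0 \<le> d \<le> 1 / 2\<close>; with
  \<open>d = 12 / L\<^sup>2\<close> this gives the constant \<open>24\<close>.\<close>

lemma ln_opnorm_iter:
  "\<bar>ln (opnorm (forward_iter A (Suc n) j))
     - (ln (a j) + (\<Sum>k<n. ln (a (j + int k + 1)) + ln (c (j + int k))))\<bar> \<le> 24 * real (Suc n) / L\<^sup>2"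
proof -
  let ?N = "opnorm (forward_iter A (Suc n) j)" and ?P = "a j * main_term j n" and ?d = "12 / L\<^sup>2"
  have d: "?d \<ge> 0" "?d \<le> 1 / 2"
    using L_ge power_mono[of 100 L 2] by (auto simp: field_simps)
  have P: "?P > 0" using a_pos main_term_pos by simp
  have low_pos: "(1 - ?d) ^ n * ?P > 0" using P d by simp
  with opnorm_iter_bounds(2)[of n j] have N: "?N > 0" by linarith
  have lnP: "ln ?P = ln (a j) + (\<Sum>k<n. ln (a (j + int k + 1)) + ln (c (j + int k)))"
    using a_pos main_term_pos c_pos
    by (simp add: ln_mult main_term_def ln_prod less_imp_neq[symmetric])
  have "ln ?N \<le> ln ((1 + ?d) ^ Suc n * ?P)"
    using opnorm_iter_bounds(1)[of n j] N by simp
  also have "\<dots> = real (Suc n) * ln (1 + ?d) + ln ?P"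
    using P d by (simp only: ln_mult_pos ln_realpow zero_less_power)
  also have "real (Suc n) * ln (1 + ?d) \<le> real (Suc n) * (2 * ?d)"
  proof (rule mult_left_mono)
    show "ln (1 + ?d) \<le> 2 * ?d"
      using ln_add_one_self_le_self[OF d(1)] d(1) by linarith
  qed simp
  finally have up: "ln ?N \<le> real (Suc n) * (2 * ?d) + ln ?P" by simp
  have "- ?d - 2 * ?d\<^sup>2 \<le> ln (1 - ?d)"
    using ln_one_minus_pos_lower_bound[OF d] .
  moreover have "2 * ?d\<^sup>2 \<le> ?d"
    using mult_left_mono[OF d(2) d(1)] by (simp add: power2_eq_square)
  ultimately have lnd: "- (2 * ?d) \<le> ln (1 - ?d)" by linarith
  have "real (Suc n) * (2 * ?d) \<ge> real n * (2 * ?d)"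
    using d by (intro mult_right_mono) auto
  then have "- (real (Suc n) * (2 * ?d)) + ln ?P \<le> real n * (- (2 * ?d)) + ln ?P"
    by simp
  also have "\<dots> \<le> real n * ln (1 - ?d) + ln ?P"
    using lnd by (intro add_right_mono mult_left_mono) auto
  also have "\<dots> = ln ((1 - ?d) ^ n * ?P)"
    using P d by (subst ln_mult_pos) (auto simp: ln_realpow)
  also have "\<dots> \<le> ln ?N"
    using opnorm_iter_bounds(2)[of n j] low_pos N by simp
  finally have "- (real (Suc n) * (2 * ?d)) + ln ?P \<le> ln ?N" .
  with up have "\<bar>ln ?N - ln ?P\<bar> \<le> real (Suc n) * (2 * ?d)" by linarith
  then show ?thesis unfolding lnP by (simp add: mult.commute)
qed

section \<open>The stable direction\<close>

lemma outside_cone_decay: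
  assumes "\<And>n. \<bar>X (j + int n) (forward_iter A (Suc n) j *v v)\<bar>
      \<le> 8 * L * \<bar>Y (j + int n) (forward_iter A (Suc n) j *v v)\<bar>"
  shows "norm (forward_iter A n j *v v) \<le> 2 * (8 * L + 1) * (1 / 2) ^ n * norm v"
proof -
  define w where "w n = forward_iter A (Suc n) j *v v" for n
  have w_Suc: "w (Suc n) = A (j + int n + 1) *v w n" for n
    unfolding w_def forward_iter_Suc_vec[of A "Suc n"] by (simp add: algebra_simps)
  have out: "\<bar>X (j + int n) (w n)\<bar> \<le> 8 * L * \<bar>Y (j + int n) (w n)\<bar>" for n
    using assms by (simp add: w_def)
  \<comment> \<open>Outside the cone \<open>Y\<close> controls the whole vector, and
    \<open>8 * L + 1 \<le> L\<^sup>2 / 2\<close> makes every step at least halve it.\<close>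
  have y: "\<bar>Y (j + int n) (w n)\<bar> \<le> (1 / 2) ^ n * norm v" for n
  proof (induction n)
    case 0
    have "\<bar>Y j (A j *v v)\<bar> = \<bar>quarter_turn (r j) \<bullet> v\<bar> / a j"
      using a_pos[of j] by (simp add: Y_apply)
    also have "\<dots> \<le> norm v / 1"
      using abs_inner_unit_le[of "quarter_turn (r j)" v] r_unit a_ge[of j] power_mono[of 100 L 2] L_ge
      by (intro frac_le) auto
    finally show ?case by (simp add: w_def)
  next
    case (Suc n)
    let ?y = "\<bar>Y (j + int n) (w n)\<bar>"
    have LL: "L\<^sup>2 \<ge> 100 * L"
      using L_ge by (simp add: power2_eq_square)
    have "\<bar>Y (j + int (Suc n)) (w (Suc n))\<bar> \<le> (\<bar>X (j + int n) (w n)\<bar> + ?y) / L\<^sup>2"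
      using step_estimates(3)[of "j + int n" "w n"] by (simp add: w_Suc algebra_simps)
    also have "\<dots> \<le> ((8 * L + 1) * ?y) / L\<^sup>2"
      using out[of n] by (intro divide_right_mono) (auto simp: algebra_simps)
    also have "\<dots> \<le> (L\<^sup>2 / 2 * ?y) / L\<^sup>2"
      using LL L_ge by (intro divide_right_mono mult_right_mono) auto
    also have "\<dots> = 1 / 2 * ?y" using L_pos by simp
    also have "\<dots> \<le> (1 / 2) ^ Suc n * norm v" using Suc by simp
    finally show ?case .
  qed
  show ?thesis
  proof (cases n)
    case 0
    have "1 * norm v \<le> 2 * (8 * L + 1) * norm v"
      using L_ge by (intro mult_right_mono) auto
    then show ?thesis by (simp add: 0)
  next
    case (Suc m)
    have "norm (w m) \<le> (8 * L + 1) * \<bar>Y (j + int m) (w m)\<bar>"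
      using norm_le_X_Y[of "w m" "j + int m"] out[of m] by (simp add: algebra_simps)
    also have "\<dots> \<le> (8 * L + 1) * ((1 / 2) ^ m * norm v)"
      using y L_pos by (intro mult_left_mono) auto
    \<comment> \<open>The vector \<open>w m\<close> is the iterate of index \<open>m + 1\<close> but
      has been halved only \<open>m\<close> times; the factor 2 makes up for this.\<close>
    also have "\<dots> = 2 * (8 * L + 1) * (1 / 2) ^ Suc m * norm v" by simp
    finally show ?thesis by (simp only: w_def Suc)
  qed
qed

text \<open>An orbit that once lies strictly inside the cone has nonzero \<open>X\<close> there,
  which doubles at every later step.\<close>

lemma bounded_orbit_outside_cone:
  assumes "v \<in> bounded_orbits A j"
  shows "\<bar>X (j + int n) (forward_iter A (Suc n) j *v v)\<bar>
      \<le> 8 * L * \<bar>Y (j + int n) (forward_iter A (Suc n) j *v v)\<bar>"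
proof (rule ccontr)
  let ?w = "forward_iter A (Suc n) j *v v" and ?k = "j + int n"
  assume "\<not> ?thesis"
  then have less: "8 * L * \<bar>Y ?k ?w\<bar> < \<bar>X ?k ?w\<bar>" by simp
  have "0 \<le> 8 * L * \<bar>Y ?k ?w\<bar>" using L_pos by simp
  with less have pos: "\<bar>X ?k ?w\<bar> > 0" by linarith
  from less have cone: "\<bar>Y ?k ?w\<bar> \<le> \<bar>X ?k ?w\<bar> / (8 * L)"
    using L_pos by (simp add: field_simps del: forward_iter.simps)
  obtain b where b: "\<And>m. norm (forward_iter A m j *v v) \<le> b"
    using assms by (auto simp: bounded_orbits_def)
  have "2 ^ m * \<bar>X ?k ?w\<bar> \<le> b" for m
  proof -
    have "2 ^ m * \<bar>X ?k ?w\<bar> \<le> \<bar>X (?k + int m) (forward_iter A m (?k + 1) *v ?w)\<bar>"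
      using cone_growth[OF cone] by blast
    also have "\<dots> \<le> norm (forward_iter A m (?k + 1) *v ?w)" by (rule abs_X_le)
    also have "?k + 1 = j + int (Suc n)" by simp
    also have "forward_iter A m (j + int (Suc n)) *v ?w = forward_iter A (Suc n + m) j *v v"
      by (simp only: forward_iter_add_vec)
    also have "norm \<dots> \<le> b" by (rule b)
    finally show ?thesis .
  qed
  moreover obtain m where "b / \<bar>X ?k ?w\<bar> < 2 ^ m"
    using real_arch_pow[of 2 "b / \<bar>X ?k ?w\<bar>"] by auto
  ultimately show False
    using pos by (simp add: field_simps not_le[symmetric] del: forward_iter.simps)
qed

lemma bounded_orbit_decay:
  assumes "v \<in> bounded_orbits A j"
  shows "norm (forward_iter A n j *v v) \<le> 2 * (8 * L + 1) * (1 / 2) ^ n * norm v"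
  using outside_cone_decay bounded_orbit_outside_cone[OF assms] by blast

lemma exists_bounded_orbit:
  obtains v where "norm v = 1" "v \<in> bounded_orbits A j"
proof -
  define F where "F n = {v. \<bar>X (j + int n) (forward_iter A (Suc n) j *v v)\<bar>
      \<le> 8 * L * \<bar>Y (j + int n) (forward_iter A (Suc n) j *v v)\<bar>} \<inter> sphere 0 1" for n
  have "\<Inter>(range F) \<noteq> {}"
  proof (rule compact_nest)
    fix n
    have "continuous_on UNIV (\<lambda>v. forward_iter A (Suc n) j *v v)"
      by (intro linear_continuous_on) simp
    then show "compact (F n)"
      unfolding F_def X_def Y_def
      by (intro closed_Int_compact closed_Collect_le continuous_intros) auto
    let ?B = "forward_iter A (Suc n) j" and ?e = "quarter_turn (u (j + int n))"
    have B: "?B \<in> SL2" by (rule forward_iter_SL2) (rule SL2)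
    \<comment> \<open>The preimage of the axis \<open>X = 0\<close>, which avoids the open cone;
      only its length has to be normalised.\<close>
    define v where "v = matrix_inv ?B *v ?e"
    have Bv: "?B *v v = ?e" unfolding v_def by (rule matrix_inv_mult_vec(2)) (rule B)
    have "norm ?e = 1" by (simp add: u_unit)
    with Bv have v0: "v \<noteq> 0" by (metis matrix_vector_mult_0_right norm_zero zero_neq_one)
    have "?B *v ((1 / norm v) *\<^sub>R v) = (1 / norm v) *\<^sub>R ?e"
      by (simp only: matrix_vector_mult_scaleR Bv)
    then have "(1 / norm v) *\<^sub>R v \<in> F n"
      using v0 L_pos by (simp add: F_def X_def Y_def del: forward_iter.simps)
    then show "F n \<noteq> {}" by blast
  next
    \<comment> \<open>By contraposition: a vector in the open wide cone is sent into the narrow one.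
      Strictness in \<open>narrow_le_wide\<close> keeps it in the open cone.\<close>
    have F_Suc: "F (Suc n) \<subseteq> F n" for n
    proof
      fix v assume v: "v \<in> F (Suc n)"
      let ?w = "forward_iter A (Suc n) j *v v" and ?k = "j + int n"
      have w_Suc: "forward_iter A (Suc (Suc n)) j *v v = A (?k + 1) *v ?w"
        unfolding forward_iter_Suc_vec[of A "Suc n"] by (simp add: algebra_simps)
      have j: "j + int (Suc n) = ?k + 1" by simp
      show "v \<in> F n"
      proof (rule ccontr)
        assume "v \<notin> F n"
        then have less: "8 * L * \<bar>Y ?k ?w\<bar> < \<bar>X ?k ?w\<bar>"
          using v by (simp add: F_def del: forward_iter.simps)
        have "0 \<le> 8 * L * \<bar>Y ?k ?w\<bar>" using L_pos by simp
        with less have pos: "\<bar>X ?k ?w\<bar> > 0" by linarith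
        from less have cone: "\<bar>Y ?k ?w\<bar> \<le> \<bar>X ?k ?w\<bar> / (8 * L)"
          using L_pos by (simp add: field_simps del: forward_iter.simps)
        let ?x = "\<bar>X (?k + 1) (A (?k + 1) *v ?w)\<bar>" and ?y = "\<bar>Y (?k + 1) (A (?k + 1) *v ?w)\<bar>"
        have x: "?x > 0" using cone_step(1)[OF cone] pos by linarith
        have "?y \<le> 6 / L^3 * ?x" by (rule cone_step(2)[OF cone])
        also have "\<dots> < 1 / (8 * L) * ?x"
          using narrow_le_wide x by (rule mult_strict_right_mono)
        finally have "8 * L * ?y < ?x"
          using L_pos by (simp add: field_simps del: forward_iter.simps)
        moreover have "?x \<le> 8 * L * ?y"
          using v by (simp only: F_def w_Suc j Int_iff mem_Collect_eq)
        ultimately show False by linarith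
      qed
    qed
    show "F n \<subseteq> F m" if "m \<le> n" for m n
      using lift_Suc_antimono_le[of F, OF F_Suc that] .
  qed
  then obtain v where v: "\<And>n. v \<in> F n" by blast
  then have v1: "norm v = 1" by (auto simp: F_def)
  have "norm (forward_iter A n j *v v) \<le> 2 * (8 * L + 1)" for n
  proof -
    have "norm (forward_iter A n j *v v) \<le> 2 * (8 * L + 1) * (1 / 2) ^ n * norm v"
      by (rule outside_cone_decay) (use v in \<open>simp only: F_def Int_iff mem_Collect_eq\<close>)
    also have "\<dots> \<le> 2 * (8 * L + 1) * 1 * norm v"
      using L_pos by (intro mult_right_mono mult_left_mono power_le_one) auto
    finally show ?thesis by (simp add: v1)
  qed
  then have "v \<in> bounded_orbits A j" by (auto simp: bounded_orbits_def)
  with v1 show ?thesis by (rule that)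
qed

text \<open>The space is not zero by \<open>exists_bounded_orbit\<close>. It is not the plane,
  because \<open>A j\<close> maps \<open>r j\<close> onto the axis of the cone, so
  \<open>r j\<close> has an unbounded orbit.\<close>

lemma bounded_orbits_RP1: "bounded_orbits A j \<in> RP1"
proof -
  have "r j \<notin> bounded_orbits A j"
  proof
    assume "r j \<in> bounded_orbits A j"
    from bounded_orbit_outside_cone[OF this, of 0] have "\<bar>X j (A j *v r j)\<bar> \<le> 8 * L * \<bar>Y j (A j *v r j)\<bar>"
      by simp
    moreover have "r j \<bullet> r j = 1" using r_unit by (simp add: norm_eq_1)
    ultimately show False using a_pos[of j] by (simp add: X_apply Y_apply)
  qed
  then have "dim (bounded_orbits A j) \<noteq> DIM(real^2)"
    using subspace_bounded_orbits[of A j] by (metis UNIV_I dim_eq_full span_eq_iff)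
  moreover have "dim (bounded_orbits A j) \<le> DIM(real^2)"
    by (rule dim_subset_UNIV)
  moreover have "dim (bounded_orbits A j) \<noteq> 0"
  proof -
    obtain v where "norm v = 1" "v \<in> bounded_orbits A j"
      by (rule exists_bounded_orbit)
    then show ?thesis by (auto simp: dim_eq_0)
  qed
  moreover have "DIM(real^2) = 2" by simp
  ultimately have "dim (bounded_orbits A j) = 1" by linarith
  then show ?thesis by (simp add: RP1_def subspace_bounded_orbits)
qed

section \<open>Time reversal and uniform hyperbolicity\<close>

lemma reversed: "singular_frames (\<lambda>j. matrix_inv (A (- j))) (\<lambda>j. a (- j))
    (\<lambda>j. quarter_turn (u (- j))) (\<lambda>j. quarter_turn (r (- j))) L"
proof
  fix j
  have inv: "matrix_inv (A (- j)) *v w = v" if "A (- j) *v v = w" for v w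
    using matrix_inv_mult_vec(1)[OF SL2] that by blast
  show "matrix_inv (A (- j)) \<in> SL2" by (intro matrix_inv_SL2 SL2)
  \<comment> \<open>The inverse expands what \<open>A (- j)\<close> contracts, by the same factor
    \<open>a (- j)\<close>.\<close>
  show "matrix_inv (A (- j)) *v quarter_turn (u (- j)) = a (- j) *\<^sub>R quarter_turn (r (- j))"
    using a_pos[of "- j"] by (intro inv) (simp add: matrix_vector_mult_scaleR shrink)
  \<comment> \<open>Two quarter turns change the sign, so the contracted direction appears as
    \<open>- u (- j)\<close>.\<close>
  have "matrix_inv (A (- j)) *v (- u (- j)) = - (1 / a (- j)) *\<^sub>R r (- j)"
  proof (rule inv)
    show "A (- j) *v (- (1 / a (- j)) *\<^sub>R r (- j)) = - u (- j)"
      unfolding matrix_vector_mult_scaleR stretch using a_pos[of "- j"] by simp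
  qed
  then show "matrix_inv (A (- j)) *v quarter_turn (quarter_turn (u (- j)))
      = (1 / a (- j)) *\<^sub>R quarter_turn (quarter_turn (r (- j)))"
    by simp
  \<comment> \<open>Reversal keeps neighbours together: this is the angle between
    \<open>A (- j - 1)\<close> and \<open>A (- j)\<close>.\<close>
  show "1 / (2 * L) \<le> \<bar>quarter_turn (u (- (j + 1))) \<bullet> quarter_turn (r (- j))\<bar>"
    using transversal[of "- j - 1"] by (simp add: inner_commute)
qed (use L_ge r_unit u_unit a_ge in auto)

end

text \<open>The first inverse to act is that of \<open>A (j - 1)\<close>, which has index
  \<open>1 - j\<close> in the reversed sequence.\<close>

lemma backward_iter_eq_forward_iter:
  "backward_iter A n j = forward_iter (\<lambda>k. matrix_inv (A (- k))) n (1 - j)"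
  by (induction n) (simp_all add: algebra_simps)

lemma uniformly_hyperbolic_of_singular_frames:
  assumes "singular_frames A a r u L"
  shows "uniformly_hyperbolic A"
proof -
  interpret F: singular_frames A a r u L by (rule assms)
  let ?R = "\<lambda>j. matrix_inv (A (- j))"
  interpret R: singular_frames ?R "\<lambda>j. a (- j)" "\<lambda>j. quarter_turn (u (- j))"
    "\<lambda>j. quarter_turn (r (- j))" L
    by (rule F.reversed)
  define ud sd where "ud j = bounded_orbits ?R (1 - j)" and "sd j = bounded_orbits A j" for j
  have "proj_act (A j) (ud j) = ud (j + 1)" for j
  proof -
    \<comment> \<open>Invariance for the reversed sequence runs from \<open>ud (j + 1)\<close> to
      \<open>ud j\<close> and is then undone by \<open>A j\<close>.\<close>
    have "ud j = proj_act (matrix_inv (A j)) (ud (j + 1))"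
      using proj_act_bounded_orbits[of ?R "- j", OF R.SL2] by (simp add: ud_def)
    then show ?thesis
      by (simp add: proj_act_def image_image matrix_inv_mult_vec[OF F.SL2])
  qed
  moreover have "proj_act (A j) (sd j) = sd (j + 1)" for j
    unfolding sd_def by (rule proj_act_bounded_orbits) (rule F.SL2)
  moreover have "ud j \<in> RP1" "sd j \<in> RP1" for j
    unfolding ud_def sd_def by (rule R.bounded_orbits_RP1, rule F.bounded_orbits_RP1)
  moreover have "norm (iter A (- n) j *v v) \<le> 2 * (8 * L + 1) * 2 powi (- n)"
    if "n \<ge> 1" "v \<in> ud j" "norm v = 1" for n j v
  proof -
    have "iter A (- n) j = forward_iter ?R (nat n) (1 - j)"
      using that by (simp add: iter_def backward_iter_eq_forward_iter)
    then show ?thesis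
      using R.bounded_orbit_decay[of v "1 - j" "nat n"] that
      by (simp add: ud_def power_int_minus power_int_def power_one_over inverse_eq_divide)
  qed
  moreover have "norm (iter A n j *v v) \<le> 2 * (8 * L + 1) * 2 powi (- n)"
    if "n \<ge> 1" "v \<in> sd j" "norm v = 1" for n j v
    using F.bounded_orbit_decay[of v j "nat n"] that
    by (simp add: iter_def sd_def power_int_minus power_int_def power_one_over inverse_eq_divide)
  moreover have "2 * (8 * L + 1) > 0" using F.L_pos by simp
  ultimately show ?thesis
    unfolding uniformly_hyperbolic_def
    by (intro exI[of _ ud] exI[of _ sd] exI[of _ "2 * (8 * L + 1)"] exI[of _ 2] conjI allI ballI impI) auto
qed

section \<open>Elimination of the angles and conclusion\<close>

lemma oriented_sum_from_0: "oriented_sum f 0 (int m - 1) = (\<Sum>k<m. f (int k))"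
proof -
  have "{0..int m - 1} = int ` {..<m}"
    using image_int_atLeastLessThan[of 0 m] by (auto simp: atLeast0LessThan)
  then show ?thesis
    by (simp add: oriented_sum_def sum.reindex)
qed

text \<open>For \<open>m = 0\<close> the oriented convention gives \<open>- f 0\<close>, so no
  exception arises.\<close>

lemma oriented_sum_from_1: "oriented_sum f 1 (int m - 1) = (\<Sum>k<m. f (int k)) - f 0"
proof (cases m)
  case (Suc n)
  have "{0..int m - 1} = insert 0 {1..int m - 1}" using Suc by auto
  then have "oriented_sum f 0 (int m - 1) = f 0 + oriented_sum f 1 (int m - 1)"
    using Suc by (simp add: oriented_sum_def)
  then show ?thesis by (simp add: oriented_sum_from_0)
qed (simp add: oriented_sum_def)

text \<open>Both the iterate and the sum of the two-matrix terms \<open>h\<close> contain the sum of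
  \<open>g (k + 1) + d k\<close>, which cancels in the difference together with all angles. The
  iterate costs \<open>24\<close> per matrix and each two-matrix product \<open>48\<close>, in total
  \<open>72\<close>.\<close>

lemma avalanche_estimate:
  assumes "singular_frames A (\<lambda>j. opnorm (A j)) r u L" and n: "n \<ge> 1"
  shows "\<bar>ln (opnorm (iter A n j))
          + oriented_sum (\<lambda>k. ln (opnorm (A (j + k)))) 1 (n - 2)
          - oriented_sum (\<lambda>k. ln (opnorm (A (j + k + 1) ** A (j + k)))) 0 (n - 2)\<bar>
        \<le> 72 * (of_int n / L\<^sup>2)"
proof -
  interpret singular_frames A "\<lambda>j. opnorm (A j)" r u L by (rule assms)
  define m where "m = nat (n - 1)"
  have nm: "n = int (Suc m)" "n - 2 = int m - 1" using n by (auto simp: m_def)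
  define g where "g k = ln (opnorm (A (j + k)))" for k
  define h where "h k = ln (opnorm (A (j + k + 1) ** A (j + k)))" for k
  define d where "d k = ln (c (j + k))" for k
  have h: "\<bar>h (int k) - (g (int k) + (g (int k + 1) + d (int k)))\<bar> \<le> 48 / L\<^sup>2" for k
    using ln_opnorm_iter[of 1 "j + int k"] by (simp add: g_def h_def d_def add.assoc)
  have "\<bar>\<Sum>k<m. h (int k) - (g (int k) + (g (int k + 1) + d (int k)))\<bar> \<le> (\<Sum>k<m. 48 / L\<^sup>2)"
    by (rule order_trans[OF sum_abs]) (intro sum_mono h)
  then have 1: "\<bar>(\<Sum>k<m. h (int k)) - ((\<Sum>k<m. g (int k)) + (\<Sum>k<m. g (int k + 1) + d (int k)))\<bar>
      \<le> 48 * real m / L\<^sup>2"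
    by (simp add: sum_subtractf sum.distrib mult.commute)
  have "iter A n j = forward_iter A (Suc m) j"
    by (simp add: iter_def nm(1) del: of_nat_Suc forward_iter.simps)
  then have 2: "\<bar>ln (opnorm (iter A n j)) - (g 0 + (\<Sum>k<m. g (int k + 1) + d (int k)))\<bar>
      \<le> 24 * real (Suc m) / L\<^sup>2"
    using ln_opnorm_iter[of m j] by (simp add: g_def d_def add.assoc del: forward_iter.simps of_nat_Suc)
  have "24 * real (Suc m) / L\<^sup>2 + 48 * real m / L\<^sup>2 \<le> 72 * (real (Suc m) / L\<^sup>2)"
    using L_pos by (simp add: field_simps)
  then have 3: "24 * real (Suc m) / L\<^sup>2 + 48 * real m / L\<^sup>2 \<le> 72 * (of_int n / L\<^sup>2)"
    by (simp add: nm(1))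
  have triangle: "\<bar>t + (x - y) - z\<bar> \<le> e"
    if "\<bar>z - (x + w)\<bar> \<le> e1" "\<bar>t - (y + w)\<bar> \<le> e2" "e2 + e1 \<le> e"
    for t w x y z e e1 e2 :: real
    using that by linarith
  have "\<bar>ln (opnorm (iter A n j)) + ((\<Sum>k<m. g (int k)) - g 0) - (\<Sum>k<m. h (int k))\<bar>
      \<le> 72 * (of_int n / L\<^sup>2)"
    by (rule triangle[OF 1 2 3])
  then show ?thesis
    unfolding nm(2) g_def[symmetric] h_def[symmetric] oriented_sum_from_0 oriented_sum_from_1 .
qed

text \<open>With \<open>L = sqrt lam\<close> the tolerance \<open>1 / 2 * ln lam\<close> is
  \<open>ln L\<close>, so exponentiating \<open>close\<close> gives the product bound with the
  factor \<open>1 / L\<close>.\<close>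

lemma obtain_singular_frames:
  assumes SL2: "\<And>j. A j \<in> SL2" and lam: "lam > 10000"
    and large: "\<And>j. opnorm (A j) \<ge> lam"
    and close: "\<And>j. \<bar>ln (opnorm (A (j + 1))) + ln (opnorm (A j)) - ln (opnorm (A (j + 1) ** A j))\<bar>
             \<le> 1 / 2 * ln lam"
  obtains r u where "singular_frames A (\<lambda>j. opnorm (A j)) r u (sqrt lam)"
proof -
  have "\<forall>j. \<exists>r u. norm r = 1 \<and> norm u = 1 \<and> A j *v r = opnorm (A j) *\<^sub>R u \<and>
      A j *v quarter_turn r = (1 / opnorm (A j)) *\<^sub>R quarter_turn u"
    using SL2_singular_frame[OF SL2] by metis
  then obtain r u where frame: "\<And>j. norm (r j) = 1" "\<And>j. norm (u j) = 1"
    "\<And>j. A j *v r j = opnorm (A j) *\<^sub>R u j"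
    "\<And>j. A j *v quarter_turn (r j) = (1 / opnorm (A j)) *\<^sub>R quarter_turn (u j)"
    by metis
  have L: "sqrt lam \<ge> 100"
    using real_sqrt_le_mono[of 10000 lam] lam real_sqrt_abs[of 100] by simp
  have L2: "(sqrt lam)\<^sup>2 = lam" using lam by simp
  have "1 / (2 * sqrt lam) \<le> \<bar>r (j + 1) \<bullet> u j\<bar>" for j
  proof (rule transversality_of_opnorm_product[OF frame[of j] frame[of "j + 1"] L])
    have pos: "opnorm (A j) > 0" "opnorm (A (j + 1)) > 0"
      using large[of j] large[of "j + 1"] lam by linarith+
    have "A (j + 1) ** A j \<in> SL2"
      using SL2[of j] SL2[of "j + 1"] by (simp add: SL2_def det_mul)
    then have prod_pos: "opnorm (A (j + 1) ** A j) > 0"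
      by (metis SL2_singular_frame)
    have "ln (opnorm (A j) * opnorm (A (j + 1)) / sqrt lam)
        = ln (opnorm (A j)) + ln (opnorm (A (j + 1))) - 1 / 2 * ln lam"
      using pos lam by (simp add: ln_div ln_mult ln_sqrt)
    also have "\<dots> \<le> ln (opnorm (A (j + 1) ** A j))"
      using close[of j] by linarith
    finally show "opnorm (A j) * opnorm (A (j + 1)) / sqrt lam \<le> opnorm (A (j + 1) ** A j)"
      using pos lam prod_pos by simp
  qed (use L2 large in auto)
  then have "singular_frames A (\<lambda>j. opnorm (A j)) r u (sqrt lam)"
    using L L2 large SL2 frame by unfold_locales simp_all
  then show ?thesis by (rule that)
qed

theorem theorem5:
  "\<exists>C::real. C > 0 \<and>
    (\<forall>(A :: int \<Rightarrow> real^2^2) (lam::real).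
      (\<forall>j. A j \<in> SL2) \<longrightarrow> lam > C \<longrightarrow>
      (\<forall>j. opnorm (A j) \<ge> lam) \<longrightarrow>
      (\<forall>j. \<bar>ln (opnorm (A (j + 1))) + ln (opnorm (A j)) - ln (opnorm (A (j + 1) ** A j))\<bar>
             \<le> 1 / 2 * ln lam) \<longrightarrow>
      uniformly_hyperbolic A \<and>
      (\<forall>j. \<forall>n::int. n \<ge> 1 \<longrightarrow>
        \<bar>ln (opnorm (iter A n j))
          + oriented_sum (\<lambda>k. ln (opnorm (A (j + k)))) 1 (n - 2)
          - oriented_sum (\<lambda>k. ln (opnorm (A (j + k + 1) ** A (j + k)))) 0 (n - 2)\<bar>
        \<le> C * (of_int n / lam)))"
proof (rule exI[of _ 10000], intro conjI allI impI)
  fix A :: "int \<Rightarrow> real^2^2" and lam :: real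
  assume "\<forall>j. A j \<in> SL2" and lam: "lam > 10000" and "\<forall>j. opnorm (A j) \<ge> lam"
    and "\<forall>j. \<bar>ln (opnorm (A (j + 1))) + ln (opnorm (A j)) - ln (opnorm (A (j + 1) ** A j))\<bar>
             \<le> 1 / 2 * ln lam"
  then obtain r u where F: "singular_frames A (\<lambda>j. opnorm (A j)) r u (sqrt lam)"
    by (rule_tac obtain_singular_frames[of A lam]) auto
  then show "uniformly_hyperbolic A" by (rule uniformly_hyperbolic_of_singular_frames)
  fix j n :: int assume n: "n \<ge> 1"
  then have "of_int n / lam \<ge> 0" using lam by simp
  \<comment> \<open>One constant serves as threshold and as error bound: \<open>10000\<close> is the
    square of the \<open>100\<close> in \<open>L_ge\<close> and exceeds \<open>72\<close>.\<close>
  then have "72 * (of_int n / lam) \<le> 10000 * (of_int n / lam)" by (intro mult_right_mono) auto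
  moreover have "(sqrt lam)\<^sup>2 = lam" using lam by simp
  ultimately show "\<bar>ln (opnorm (iter A n j))
          + oriented_sum (\<lambda>k. ln (opnorm (A (j + k)))) 1 (n - 2)
          - oriented_sum (\<lambda>k. ln (opnorm (A (j + k + 1) ** A (j + k)))) 0 (n - 2)\<bar>
        \<le> 10000 * (of_int n / lam)"
    using avalanche_estimate[OF F n, of j] by simp
qed simp

end
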